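(* The abstract factorial given by $$n!_{a}=\prod_{p}p^{\sum_{m=0}^{\infty}\left\lfloor\frac{n}{p^m(p-1)}\right\rfloor}\qquad(n\ge0),$$ the product being over all primes $p$, has as a primitive the ordered set $X=\{b_i\}_{i\ge1}$ where $b_1=2$ and the remaining $b_n$ are given recursively by $$b_n=\frac{n!_{a}}{\prod_{i=1}^{n-1}b_i^{\lfloor n/i\rfloor}},\qquad n>1,$$ and explicitly as follows: $$b_i=\begin{cases}1, & \text{if } i\ne p^m(p-1)\text{ for every prime } p\text{ and every } m\ge0,\\[4pt] \displaystyle\prod_{p\,:\; i=p^m(p-1)\text{ for some } m\ge0}p, & \text{if } i=p^m(p-1)\text{ for some prime } p\text{ and some } m\ge0,\end{cases}$$ where the product extends over all primes $p$ such that $i$ has a representation $i=p^m(p-1)$ for some integer $m\ge0$.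
   Context: An abstract factorial is a function $!_{a}:\mathbb{N}\to\mathbb{Z}^+$ ($\mathbb{N}=\{0,1,2,\dots\}$) with (1) $0!_{a}=1$; (2) $\frac{n!_{a}}{k!_{a}(n-k)!_{a}}\in\mathbb{Z}^+$ for all $0\le k\le n$; (3) $n!\mid n!_{a}$ for every $n\ge1$. Given a sequence $(b_1,b_2,\dots)$ of positive integers (repetitions allowed), its factorial set (with first element $b_1$) is the sequence $B_0=1$, $B_n=\prod_{i=1}^{n}b_i^{\lfloor n/i\rfloor}$ for $n\ge1$. The ordered set $X=\{b_n\}$ is called a primitive of an abstract factorial $!_{a}$ if the sequence $\{n!_{a}\}_{n\ge0}$ coincides with a factorial set of $X$, i.e. $n!_{a}=B_n$ for all $n\ge0$. *)

theory Defs
  imports Complex_Main "HOL-Computational_Algebra.Primes" "HOL-Library.Groups_Big_Fun"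
begin

text \<open>Positive integers are rendered as positive elements of \<^typ>\<open>nat\<close>; for a positive \<open>f\<close>,
  integrality of the generalized binomial coefficients is divisibility (the quotients are then
  automatically positive).\<close>

definition abstract_factorial :: "(nat \<Rightarrow> nat) \<Rightarrow> bool" where
  "abstract_factorial f \<longleftrightarrow>
     (\<forall>n. f n > 0) \<and>
     f 0 = 1 \<and>
     (\<forall>n k. k \<le> n \<longrightarrow> f k * f (n - k) dvd f n) \<and>
     (\<forall>n\<ge>1. fact n dvd f n)"

text \<open>Sequences \<open>b\<^sub>1, b\<^sub>2, \<dots>\<close> are functions on \<^typ>\<open>nat\<close> whose value at \<open>0\<close> is never used.\<close>

definition factorial_set :: "(nat \<Rightarrow> nat) \<Rightarrow> nat \<Rightarrow> nat" where
  "factorial_set b n = (\<Prod>i=1..n. b i ^ (n div i))"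

definition is_primitive :: "(nat \<Rightarrow> nat) \<Rightarrow> (nat \<Rightarrow> nat) \<Rightarrow> bool" where
  "is_primitive b f \<longleftrightarrow> (\<forall>i\<ge>1. b i > 0) \<and> (\<forall>n. f n = factorial_set b n)"

text \<open>\<^const>\<open>Sum_any\<close> and \<^const>\<open>Prod_any\<close> are the sum and the product over the whole type of a
  function that differs from \<open>0\<close>, respectively \<open>1\<close>, at finitely many arguments only. The lemmas
  following the definitions show that this finiteness holds here.\<close>

definition prime_exponent :: "nat \<Rightarrow> nat \<Rightarrow> nat" where
  "prime_exponent n p = Sum_any (\<lambda>m. n div (p ^ m * (p - 1)))"

definition prime_factorial :: "nat \<Rightarrow> nat" where
  "prime_factorial n = Prod_any (\<lambda>p. if prime p then p ^ prime_exponent n p else 1)"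

lemma finite_exponent_support:
  fixes n p :: nat
  assumes "prime p"
  shows "finite {m. n div (p ^ m * (p - 1)) \<noteq> 0}"
proof (rule finite_subset)
  show "{m. n div (p ^ m * (p - 1)) \<noteq> 0} \<subseteq> {..n}"
  proof
    fix m assume "m \<in> {m. n div (p ^ m * (p - 1)) \<noteq> 0}"
    then have "p ^ m * (p - 1) \<le> n"
      by (simp add: div_eq_0_iff not_less)
    moreover have "p ^ m * 1 \<le> p ^ m * (p - 1)"
      using prime_ge_2_nat[OF assms] by (intro mult_le_mono) auto
    moreover have "m < p ^ m"
      using prime_ge_2_nat[OF assms] by (intro power_gt_expt) auto
    ultimately show "m \<in> {..n}"
      unfolding atMost_iff by linarith
  qed
qed simp

lemma prime_exponent_eq_0:
  fixes n p :: nat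
  assumes "p > n + 1"
  shows "prime_exponent n p = 0"
proof -
  have "n div (p ^ m * (p - 1)) = 0" for m
  proof -
    have "1 * (p - 1) \<le> p ^ m * (p - 1)"
      using assms by (intro mult_le_mono) auto
    then show ?thesis using assms by (intro div_less) linarith
  qed
  then show ?thesis by (simp add: prime_exponent_def)
qed

lemma finite_factorial_support:
  "finite {p. (if prime p then p ^ prime_exponent n p else 1) \<noteq> 1}"
proof (rule finite_subset)
  show "{p. (if prime p then p ^ prime_exponent n p else 1) \<noteq> 1} \<subseteq> {..n + 1}"
  proof
    fix p assume "p \<in> {p. (if prime p then p ^ prime_exponent n p else 1) \<noteq> 1}"
    then have "prime_exponent n p \<noteq> 0"
      by (cases "prime p") (auto intro: ccontr)
    then show "p \<in> {..n + 1}"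
      using prime_exponent_eq_0[of n p] by (cases "p > n + 1") auto
  qed
qed simp

definition primitive_seq :: "nat \<Rightarrow> nat" where
  "primitive_seq i =
     (if \<exists>p m. prime p \<and> i = p ^ m * (p - 1)
      then \<Prod>p | prime p \<and> (\<exists>m. i = p ^ m * (p - 1)). p
      else 1)"

lemma finite_representing_primes:
  fixes i :: nat
  shows "finite {p. prime p \<and> (\<exists>m. i = p ^ m * (p - 1))}"
proof (rule finite_subset)
  show "{p. prime p \<and> (\<exists>m. i = p ^ m * (p - 1))} \<subseteq> {..i + 1}"
  proof
    fix p assume "p \<in> {p. prime p \<and> (\<exists>m. i = p ^ m * (p - 1))}"
    then obtain m where p: "prime p" and i: "i = p ^ m * (p - 1)" by blast
    have "1 * (p - 1) \<le> p ^ m * (p - 1)"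
      using prime_gt_0_nat[OF p] by (intro mult_le_mono) auto
    then show "p \<in> {..i + 1}"
      unfolding i atMost_iff by linarith
  qed
qed simp

end

theory Submission
  imports Defs
begin

text \<open>Each pair \<open>(p, m)\<close> with \<open>p\<close> prime contributes the factor \<open>p ^ (n div i)\<close> to the factorial,
  where \<open>i = p ^ m * (p - 1)\<close>; grouping the pairs by the value of \<open>i\<close> instead of by \<open>p\<close> exhibits the
  factorial set of the claimed primitive. Factorial sets have integral binomial coefficients because
  \<open>k div i + l div i \<le> (k + l) div i\<close>, and divisibility by \<open>fact n\<close> follows from Legendre's formula,
  since \<open>p ^ m * (p - 1) \<le> p ^ Suc m\<close>.\<close>

section \<open>Factorial sets of arbitrary sequences\<close>

lemma div_add_div_le: "k div i + l div i \<le> (k + l) div (i :: nat)"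
  by (subst div_add1_eq) simp

text \<open>Factors with \<open>i > n\<close> have exponent \<open>n div i = 0\<close>; padding with
  them puts factorial sets of different indices on one common range.\<close>

lemma factorial_set_eq:
  assumes "n \<le> N"
  shows "factorial_set b n = (\<Prod>i=1..N. b i ^ (n div i))"
  unfolding factorial_set_def
  by (rule prod.mono_neutral_left) (use assms in auto)

lemma factorial_set_dvd:
  assumes "k \<le> n"
  shows "factorial_set b k * factorial_set b (n - k) dvd factorial_set b n"
proof -
  have "factorial_set b k * factorial_set b (n - k) =
      (\<Prod>i=1..n. b i ^ (k div i + (n - k) div i))"
    using assms by (simp add: factorial_set_eq[of _ n] prod.distrib power_add)
  also have "\<dots> dvd factorial_set b n"
    unfolding factorial_set_def
  proof (intro prod_dvd_prod le_imp_power_dvd)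
    fix i
    show "k div i + (n - k) div i \<le> n div i"
      using div_add_div_le[of k i "n - k"] assms by simp
  qed
  finally show ?thesis .
qed

lemma factorial_set_rec:
  assumes "n > 0"
  shows "factorial_set b n = (\<Prod>i=1..n - 1. b i ^ (n div i)) * b n"
  using assms by (cases n) (simp_all add: factorial_set_def)

section \<open>Finite forms of the infinite sum and product\<close>

text \<open>Since \<open>m < p ^ m \<le> p ^ m * (p - 1)\<close>, terms with \<open>m > n\<close>
  vanish. The cutoff is the same for every \<open>p\<close>, which later allows the products to be
  interchanged.\<close>

lemma prime_exponent_eq:
  assumes "prime p"
  shows "prime_exponent n p = (\<Sum>m\<le>n. n div (p ^ m * (p - 1)))"
  unfolding prime_exponent_def
proof (rule Sum_any.expand_superset)
  show "{m. n div (p ^ m * (p - 1)) \<noteq> 0} \<subseteq> {..n}"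
  proof
    fix m assume "m \<in> {m. n div (p ^ m * (p - 1)) \<noteq> 0}"
    then have "p ^ m * (p - 1) \<le> n" by (simp add: div_greater_zero_iff)
    moreover have "p ^ m * 1 \<le> p ^ m * (p - 1)" 
      using prime_ge_2_nat[OF assms] by (intro mult_le_mono) auto
    moreover have "m < p ^ m"
      using prime_ge_2_nat[OF assms] by (intro power_gt_expt) auto
    ultimately show "m \<in> {..n}" unfolding atMost_iff by linarith
  qed
qed simp

lemma prime_factorial_eq:
  "prime_factorial n = (\<Prod>p | prime p \<and> p \<le> n + 1. p ^ prime_exponent n p)"
proof -
  have "prime_factorial n =
      (\<Prod>p\<in>{..n + 1}. if prime p then p ^ prime_exponent n p else 1)"
    unfolding prime_factorial_def
  proof (rule Prod_any.expand_superset)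
    show "{p. (if prime p then p ^ prime_exponent n p else 1) \<noteq> 1} \<subseteq> {..n + 1}"
    proof
      fix p assume "p \<in> {p. (if prime p then p ^ prime_exponent n p else 1) \<noteq> 1}"
      then show "p \<in> {..n + 1}"
        using prime_exponent_eq_0[of n p] by (cases "p > n + 1") (auto split: if_splits)
    qed
  qed simp
  also have "\<dots> = (\<Prod>p\<in>{p \<in> {..n + 1}. prime p}. p ^ prime_exponent n p)"
    by (rule prod.inter_filter[symmetric]) simp
  also have "{p \<in> {..n + 1}. prime p} = {p. prime p \<and> p \<le> n + 1}"
    by auto
  finally show ?thesis .
qed

lemma primitive_seq_eq:
  "primitive_seq i = (\<Prod>p | prime p \<and> (\<exists>m. i = p ^ m * (p - 1)). p)"
proof (cases "\<exists>p m. prime p \<and> i = p ^ m * (p - 1)")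
  case False
  then have "{p. prime p \<and> (\<exists>m. i = p ^ m * (p - 1))} = {}" by blast
  then have "(\<Prod>p | prime p \<and> (\<exists>m. i = p ^ m * (p - 1)). p) = 1" by (simp only: prod.empty)
  with False show ?thesis by (simp only: primitive_seq_def if_False)
qed (simp only: primitive_seq_def if_True)

lemma primitive_seq_pos: "primitive_seq i > 0"
  unfolding primitive_seq_eq by (rule prod_pos) (auto simp: prime_gt_0_nat)

section \<open>Regrouping prime powers by the value of \<open>p ^ m * (p - 1)\<close>\<close>

lemma prime_power_shift_inj:
  assumes "prime (p :: nat)" "p ^ m * (p - 1) = p ^ k * (p - 1)"
  shows "m = k"
  using assms prime_gt_1_nat[OF assms(1)] by auto

text \<open>The representation \<open>i = p ^ m * (p - 1)\<close> determines \<open>m\<close>, so that each prime occurs at most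
  once in the double product.\<close>

lemma primitive_seq_eq_double_prod:
  assumes "0 < i" "i \<le> n"
  shows "primitive_seq i =
    (\<Prod>p | prime p \<and> p \<le> n + 1. \<Prod>m\<le>n. if i = p ^ m * (p - 1) then p else 1)"
proof -
  let ?P = "{p. prime p \<and> p \<le> n + 1}"
  \<comment> \<open>Both \<open>p - 1\<close> and \<open>p ^ m\<close> are at most \<open>i\<close>,
    so the finite box of pairs misses no representation of \<open>i\<close>.\<close>
  have bound: "p \<le> n + 1 \<and> m \<le> n" if "prime p" "i = p ^ m * (p - 1)" for p m
  proof -
    have p: "p \<ge> 2" using that(1) by (rule prime_ge_2_nat)
    have "p ^ m * 1 \<le> p ^ m * (p - 1)" "1 * (p - 1) \<le> p ^ m * (p - 1)"
      using p by (intro mult_le_mono; simp)+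
    moreover have "m < p ^ m" using p by (intro power_gt_expt) auto
    ultimately show ?thesis using that(2) assms by linarith
  qed
  have inner: "(\<Prod>m\<le>n. if i = p ^ m * (p - 1) then p else 1) =
      (if \<exists>m. i = p ^ m * (p - 1) then p else 1)" if p: "prime p" for p
  proof (cases "\<exists>m. i = p ^ m * (p - 1)")
    case True
    then obtain k where k: "i = p ^ k * (p - 1)" by blast
    have "(\<Prod>m\<le>n. if i = p ^ m * (p - 1) then p else 1) = (\<Prod>m\<le>n. if m = k then p else 1)"
      using prime_power_shift_inj[OF p] k by (intro prod.cong) auto
    then show ?thesis using bound[OF p k] True by (simp add: prod.delta)
  qed auto
  have "primitive_seq i = (\<Prod>p\<in>{p \<in> ?P. \<exists>m. i = p ^ m * (p - 1)}. p)"
    unfolding primitive_seq_eq by (rule prod.cong) (use bound in blast)+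
  also have "\<dots> = (\<Prod>p\<in>?P. if \<exists>m. i = p ^ m * (p - 1) then p else 1)"
    by (rule prod.inter_filter) simp
  also have "\<dots> = (\<Prod>p\<in>?P. \<Prod>m\<le>n. if i = p ^ m * (p - 1) then p else 1)"
    by (intro prod.cong) (use inner in auto)
  finally show ?thesis .
qed

lemma prime_factorial_eq_factorial_set:
  "prime_factorial n = factorial_set primitive_seq n"
proof -
  let ?P = "{p. prime p \<and> p \<le> n + 1}"
  \<comment> \<open>Writing the exponent through \<open>p\<close> and \<open>m\<close> leaves
    \<open>i\<close> only in the condition, so the product over \<open>i\<close> can be moved
    innermost and collapsed.\<close>
  have "factorial_set primitive_seq n = (\<Prod>i=1..n. \<Prod>p\<in>?P. \<Prod>m\<le>n.
      if i = p ^ m * (p - 1) then p ^ (n div (p ^ m * (p - 1))) else 1)"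
    unfolding factorial_set_def
  proof (rule prod.cong[OF refl])
    fix i assume "i \<in> {1..n}"
    then have "primitive_seq i =
        (\<Prod>p\<in>?P. \<Prod>m\<le>n. if i = p ^ m * (p - 1) then p else 1)"
      by (intro primitive_seq_eq_double_prod) auto
    then have "primitive_seq i ^ (n div i) = (\<Prod>p\<in>?P. \<Prod>m\<le>n.
        (if i = p ^ m * (p - 1) then p else 1) ^ (n div i))"
      by (simp only: prod_power_distrib)
    also have "\<dots> = (\<Prod>p\<in>?P. \<Prod>m\<le>n.
        if i = p ^ m * (p - 1) then p ^ (n div (p ^ m * (p - 1))) else 1)"
      by (intro prod.cong refl) simp
    finally show "primitive_seq i ^ (n div i) = (\<Prod>p\<in>?P. \<Prod>m\<le>n.
        if i = p ^ m * (p - 1) then p ^ (n div (p ^ m * (p - 1))) else 1)" .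
  qed
  also have "\<dots> = (\<Prod>p\<in>?P. \<Prod>m\<le>n. \<Prod>i=1..n.
      if i = p ^ m * (p - 1) then p ^ (n div (p ^ m * (p - 1))) else 1)"
    by (subst prod.swap, rule prod.cong[OF refl], rule prod.swap)
  also have "\<dots> = (\<Prod>p\<in>?P. \<Prod>m\<le>n. p ^ (n div (p ^ m * (p - 1))))"
  \<comment> \<open>At most one \<open>i\<close> contributes. If \<open>p ^ m * (p - 1) > n\<close>,
    none does, but then the exponent on the right is 0 as well.\<close>
  proof (intro prod.cong refl)
    fix p m assume "p \<in> ?P"
    then have "p ^ m * (p - 1) > 0" using prime_gt_1_nat[of p] by simp
    then show "(\<Prod>i=1..n. if i = p ^ m * (p - 1) then p ^ (n div (p ^ m * (p - 1))) else 1) =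
        p ^ (n div (p ^ m * (p - 1)))"
      by (auto simp: prod.delta not_le Suc_le_eq)
  qed
  also have "\<dots> = (\<Prod>p\<in>?P. p ^ prime_exponent n p)"
    by (intro prod.cong refl) (simp add: prime_exponent_eq power_sum)
  finally show ?thesis by (simp add: prime_factorial_eq)
qed

section \<open>Legendre's bound and divisibility by \<open>fact n\<close>\<close>

text \<open>Passing from \<open>n\<close> to \<open>Suc n\<close> adds the multiplicity of
  \<open>p\<close> in \<open>Suc n\<close>, and the quotient by each power of \<open>p\<close>
  dividing \<open>Suc n\<close> grows by one. The fixed \<open>N\<close> keeps the range of
  summation constant in the induction.\<close>

lemma multiplicity_fact_le:
  assumes p: "prime p" and "n \<le> N"
  shows "multiplicity p (fact n :: nat) \<le> (\<Sum>m<N. n div p ^ Suc m)"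
  using assms(2)
proof (induction n)
  case (Suc n)
  let ?k = "multiplicity p (Suc n)"
  have "p \<ge> 2" using p by (rule prime_ge_2_nat)
  have dvd: "p ^ Suc m dvd Suc n" if "m < ?k" for m
    using that by (intro multiplicity_dvd') simp
  have "?k < p ^ ?k" using \<open>p \<ge> 2\<close> by (intro power_gt_expt) auto
  also have "\<dots> \<le> Suc n" by (intro dvd_imp_le multiplicity_dvd) simp
  \<comment> \<open>Hence the indicator sum over \<open>m < N\<close> below reaches the full value
    \<open>?k\<close>.\<close>
  finally have "?k \<le> N" using Suc.prems by simp
  have "multiplicity p (fact (Suc n) :: nat) = ?k + multiplicity p (fact n :: nat)"
    unfolding fact_Suc of_nat_id
    by (rule prime_elem_multiplicity_mult_distrib) (use p in auto)
  also have "\<dots> \<le> (\<Sum>m<N. if m < ?k then 1 else 0) + (\<Sum>m<N. n div p ^ Suc m)"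
  proof (rule add_mono)
    have "?k = (\<Sum>m<?k. if m < ?k then 1 else 0)" by simp
    also have "\<dots> \<le> (\<Sum>m<N. if m < ?k then 1 else 0)"
      by (rule sum_mono2) (use \<open>?k \<le> N\<close> in auto)
    finally show "?k \<le> (\<Sum>m<N. if m < ?k then 1 else 0)" .
  qed (use Suc in simp)
  also have "\<dots> \<le> (\<Sum>m<N. Suc n div p ^ Suc m)"
    unfolding sum.distrib[symmetric]
  proof (rule sum_mono)
    fix m
    show "(if m < ?k then 1 else 0) + n div p ^ Suc m \<le> Suc n div p ^ Suc m"
      using dvd[of m] by (auto simp: div_Suc mod_eq_0_iff_dvd)
  qed
  finally show ?case .
qed simp

lemma fact_dvd_prime_factorial: "fact n dvd prime_factorial n"
proof -
  have le: "multiplicity p (fact n :: nat) \<le> prime_exponent n p" if p: "prime p" for p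
  proof -
    have "p > 1" using p by (rule prime_gt_1_nat)
    have "multiplicity p (fact n :: nat) \<le> (\<Sum>m<n. n div p ^ Suc m)"
      using p by (rule multiplicity_fact_le) simp
    \<comment> \<open>The smaller divisor \<open>p ^ m * (p - 1) \<le> p ^ Suc m\<close> is
      positive, so the quotient can only grow.\<close>
    also have "\<dots> \<le> (\<Sum>m<n. n div (p ^ m * (p - 1)))"
      using \<open>p > 1\<close> by (intro sum_mono div_le_mono2) auto
    also have "\<dots> \<le> prime_exponent n p"
      unfolding prime_exponent_eq[OF p] by (rule sum_mono2) auto
    finally show ?thesis .
  qed
  have "(fact n :: nat) = (\<Prod>p\<in>prime_factors (fact n). p ^ multiplicity p (fact n))"
    by (rule prime_factorization_nat) simp
  also have "\<dots> dvd (\<Prod>p\<in>prime_factors (fact n). p ^ prime_exponent n p)"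
    by (intro prod_dvd_prod le_imp_power_dvd le) auto
  also have "\<dots> dvd (\<Prod>p | prime p \<and> p \<le> n + 1. p ^ prime_exponent n p)"
  proof (rule prod_dvd_prod_subset)
    show "prime_factors (fact n :: nat) \<subseteq> {p. prime p \<and> p \<le> n + 1}"
      by (auto simp: in_prime_factors_iff prime_dvd_fact_iff)
  qed simp
  also have "\<dots> = prime_factorial n" by (rule prime_factorial_eq[symmetric])
  finally show ?thesis .
qed

section \<open>The first term and the conclusion\<close>

lemma primitive_seq_1: "primitive_seq 1 = 2"
proof -
  have "{p. prime p \<and> (\<exists>m. 1 = p ^ m * (p - 1))} = {2 :: nat}"
  proof safe
    fix p m :: nat assume "prime p" "1 = p ^ m * (p - 1)"
    then have "p - 1 = 1" by (metis nat_mult_eq_1_iff)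
    then show "p = 2" by simp
  \<comment> \<open>Conversely, \<open>1 = 2 ^ 0 * (2 - 1)\<close>.\<close>
  qed (auto intro: exI[of _ 0])
  then show ?thesis by (simp add: primitive_seq_eq)
qed

theorem theorem37:
  "abstract_factorial prime_factorial \<and>
   (\<exists>b :: nat \<Rightarrow> nat.
      is_primitive b prime_factorial \<and>
      b 1 = 2 \<and>
      (\<forall>n>1. real (b n) = real (prime_factorial n) / real (\<Prod>i=1..n - 1. b i ^ (n div i))) \<and>
      (\<forall>i\<ge>1. b i = primitive_seq i))"
proof (intro conjI exI[of _ primitive_seq])
  have pos: "factorial_set primitive_seq n > 0" for n
    unfolding factorial_set_def by (intro prod_pos) (simp add: primitive_seq_pos)
  show "abstract_factorial prime_factorial"
    unfolding abstract_factorial_def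
    using pos factorial_set_dvd[of _ _ primitive_seq] fact_dvd_prime_factorial
    by (simp add: prime_factorial_eq_factorial_set) (simp add: factorial_set_def)
  show "is_primitive primitive_seq prime_factorial"
    by (simp add: is_primitive_def primitive_seq_pos prime_factorial_eq_factorial_set)
  show "\<forall>n>1. real (primitive_seq n) =
      real (prime_factorial n) / real (\<Prod>i=1..n - 1. primitive_seq i ^ (n div i))"
  proof (intro allI impI)
    fix n :: nat assume "n > 1"
    then have "prime_factorial n =
        (\<Prod>i=1..n - 1. primitive_seq i ^ (n div i)) * primitive_seq n"
      by (simp only: prime_factorial_eq_factorial_set factorial_set_rec)
    \<comment> \<open>A nonzero denominator turns the product identity into the quotient formula
      over the reals.\<close>
    moreover have "(\<Prod>i=1..n - 1. primitive_seq i ^ (n div i)) > 0"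
      by (intro prod_pos) (simp add: primitive_seq_pos)
    ultimately show "real (primitive_seq n) =
        real (prime_factorial n) / real (\<Prod>i=1..n - 1. primitive_seq i ^ (n div i))"
      by (simp only: of_nat_mult) (simp del: of_nat_prod)
  qed
qed (rule primitive_seq_1, simp)

end
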